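(* Let $\Omega$ be a semigroup with unit $1$ and let $(A,\mu,N)$ be a Nijenhuis family $\Omega$-associative algebra. If $\mathrm{H}^2_{\mathrm{NFA}}(A)=0$, then $(A,\mu,N)$ is rigid, i.e. every one-parameter formal deformation of $(A,\mu,N)$ is trivial.
   Context: All vector spaces are over a field $\mathbf{k}$. An $\Omega$-associative algebra is a vector space $A$ with bilinear operations $\mu_{\alpha,\beta}:A\otimes A\to A$, $a\otimes b\mapsto a\cdot_{\alpha,\beta}b$ ($\alpha,\beta\in\Omega$), such that $(a\cdot_{\alpha,\beta}b)\cdot_{\alpha\beta,\gamma}c=a\cdot_{\alpha,\beta\gamma}(b\cdot_{\beta,\gamma}c)$. A Nijenhuis family $\Omega$-associative algebra $(A,\mu,N)$ is an $\Omega$-associative algebra with linear maps $N_\omega:A\to A$ ($\omega\in\Omega$) such that $N_\alpha(a)\cdot_{\alpha,\beta}N_\beta(b)=N_{\alpha\beta}\big(N_\alpha(a)\cdot_{\alpha,\beta}b+a\cdot_{\alpha,\beta}N_\beta(b)-N_{\alpha\beta}(a\cdot_{\alpha,\beta}b)\big)$. A one-parameter formal deformation of $(A,\mu,N)$ is a pair $\mu_t=\sum_{i\ge0}\mu_it^i$, $N_t=\sum_{i\ge0}N_it^i$, where $\mu_i=\{\mu_{i,\alpha,\beta}\}_{\alpha,\beta\in\Omega}$ is a family of linear maps $A\otimes A\to A$, $N_i=\{N_{i,\omega}\}_{\omega\in\Omega}$ a family of linear maps $A\to A$, $\mu_0=\mu$, $N_0=N$, such that $(A[\![t]\!],\mu_t,N_t)$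 (with $\mu_t,N_t$ extended $\mathbf{k}[\![t]\!]$-(bi)linearly) is a Nijenhuis family $\Omega$-associative algebra over $\mathbf{k}[\![t]\!]$. Two deformations $(\mu_t,N_t)$, $(\mu'_t,N'_t)$ are equivalent if there is a family $\psi_t=\{\psi_{t,\theta}\}_{\theta\in\Omega}$, $\psi_{t,\theta}=\sum_{i\ge0}\psi_{i,\theta}t^i$, with $\psi_{i,\theta}:A\to A$ linear and $\psi_{0,\theta}=\mathrm{id}_A$, such that $\psi_{t,\alpha\beta}\circ\mu'_{t,\alpha,\beta}=\mu_{t,\alpha,\beta}\circ(\psi_{t,\alpha}\otimes\psi_{t,\beta})$ and $\psi_{t,\omega}\circ N'_{t,\omega}=N_{t,\omega}\circ\psi_{t,\omega}$ for all $\alpha,\beta,\omega\in\Omega$. A deformation is trivial if it is equivalent to the one with $\mu_i=0$ and $N_i=0$ for all $i\ge1$. Cohomology: $\mathrm{H}^2_{\mathrm{NFA}}(A)=\ker d^2/\operatorname{im}d^1$. Here $C^1_{\mathrm{NFA}}(A)$ consists of pairs $(f,m)$ with $f=\{f_\alpha\}$ a family of linear maps $A\to A$ and $m\in A$; $C^2_{\mathrm{NFA}}(A)$ consists of pairs $(f,g)$ with $f=\{f_{\alpha,\beta}\}$ a family of linear maps $A^{\otimes2}\to A$ and $g=\{g_\alpha\}$ a family of linear maps $A\to A$; $d^1(f,m)=(\delta^1(f),-\partial^0(m)-\Phi^1(f))$ and $d^2(f,g)=(\delta^2(f),-\partial^1(g)-\Phi^2(f))$, where $\delta^1(f)_{\alpha,\beta}(a,b)=a\cdot_{\alpha,\beta}f_\beta(b)-f_{\alpha\beta}(a\cdot_{\alpha,\beta}b)+f_\alpha(a)\cdot_{\alpha,\beta}b$;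 $\delta^2(f)_{\alpha,\beta,\gamma}(a,b,c)=-a\cdot_{\alpha,\beta\gamma}f_{\beta,\gamma}(b,c)+f_{\alpha\beta,\gamma}(a\cdot_{\alpha,\beta}b,c)-f_{\alpha,\beta\gamma}(a,b\cdot_{\beta,\gamma}c)+f_{\alpha,\beta}(a,b)\cdot_{\alpha\beta,\gamma}c$; $\partial^0(m)_\alpha(a)=N_\alpha(a)\cdot_{\alpha,1}m-m\cdot_{1,\alpha}N_\alpha(a)-N_\alpha(a\cdot_{\alpha,1}m-m\cdot_{1,\alpha}a)$; $\partial^1(g)_{\alpha,\beta}(a,b)=N_\alpha(a)\cdot_{\alpha,\beta}g_\beta(b)-N_{\alpha\beta}(a\cdot_{\alpha,\beta}g_\beta(b))-g_{\alpha\beta}\big(N_\alpha(a)\cdot_{\alpha,\beta}b+a\cdot_{\alpha,\beta}N_\beta(b)-N_{\alpha\beta}(a\cdot_{\alpha,\beta}b)\big)+g_\alpha(a)\cdot_{\alpha,\beta}N_\beta(b)-N_{\alpha\beta}(g_\alpha(a)\cdot_{\alpha,\beta}b)$; $\Phi^1(f)_\alpha(a)=f_\alpha(N_\alpha(a))-N_\alpha(f_\alpha(a))$; $\Phi^2(f)_{\alpha,\beta}(a,b)=f_{\alpha,\beta}(N_\alpha(a),N_\beta(b))-N_{\alpha\beta}f_{\alpha,\beta}(N_\alpha(a),b)-N_{\alpha\beta}f_{\alpha,\beta}(a,N_\beta(b))+N_{\alpha\beta}^2f_{\alpha,\beta}(a,b)$.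
   Formalization: The formula for ∂¹(g)_{α,β}(a,b) is corrected by adding the missing summand + N_{αβ}(g_{αβ}(a·_{α,β}b)); without it the claim fails, e.g. for A = k, Ω = {1}, N = id, with the nontrivial deformation N_t = (1+t)id. *)

theory Defs
  imports
    "HOL-Library.Function_Algebras"
    "HOL-Library.Product_Plus"
    "HOL-Computational_Algebra.Formal_Power_Series"
begin

section \<open>Nijenhuis family \<open>\<Omega>\<close>-associative algebras\<close>

text \<open>
  A linear map out of \<open>A \<otimes> A\<close> is rendered as a curried map that is linear in each
  argument. The scalars range over a commutative ring, so that one and the same notion applies
  to \<open>A\<close> over the field \<open>k\<close> and to \<open>A[[t]]\<close> over \<open>k[[t]]\<close>; for a field,
  \<^locale>\<open>module\<close> is the same as \<^locale>\<open>vector_space\<close>.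
\<close>

definition bilinear_op ::
  "('r::comm_ring_1 \<Rightarrow> 'a::ab_group_add \<Rightarrow> 'a) \<Rightarrow> ('a \<Rightarrow> 'a \<Rightarrow> 'a) \<Rightarrow> bool" where
  "bilinear_op scale f \<longleftrightarrow>
     (\<forall>a. module_hom scale scale (\<lambda>b. f a b)) \<and> (\<forall>b. module_hom scale scale (\<lambda>a. f a b))"

locale omega_associative_algebra = module scale
  for scale :: "'r::comm_ring_1 \<Rightarrow> 'a::ab_group_add \<Rightarrow> 'a" +
  fixes mul :: "'w::monoid_mult \<Rightarrow> 'w \<Rightarrow> 'a \<Rightarrow> 'a \<Rightarrow> 'a"
  assumes bilinear_mul: "bilinear_op scale (mul \<alpha> \<beta>)"
    and mul_assoc: "mul (\<alpha> * \<beta>) \<gamma> (mul \<alpha> \<beta> a b) c = mul \<alpha> (\<beta> * \<gamma>) a (mul \<beta> \<gamma> b c)"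

locale nijenhuis_family_algebra = omega_associative_algebra scale mul
  for scale :: "'r::comm_ring_1 \<Rightarrow> 'a::ab_group_add \<Rightarrow> 'a"
    and mul :: "'w::monoid_mult \<Rightarrow> 'w \<Rightarrow> 'a \<Rightarrow> 'a \<Rightarrow> 'a" +
  fixes N :: "'w \<Rightarrow> 'a \<Rightarrow> 'a"
  assumes linear_N: "module_hom scale scale (N \<omega>)"
    and nijenhuis: "mul \<alpha> \<beta> (N \<alpha> a) (N \<beta> b) =
      N (\<alpha> * \<beta>) (mul \<alpha> \<beta> (N \<alpha> a) b + mul \<alpha> \<beta> a (N \<beta> b) - N (\<alpha> * \<beta>) (mul \<alpha> \<beta> a b))"

section \<open>Cohomology in degree two\<close>

definition delta1 ::
  "('w::monoid_mult \<Rightarrow> 'w \<Rightarrow> 'a::ab_group_add \<Rightarrow> 'a \<Rightarrow> 'a) \<Rightarrow>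
   ('w \<Rightarrow> 'a \<Rightarrow> 'a) \<Rightarrow> 'w \<Rightarrow> 'w \<Rightarrow> 'a \<Rightarrow> 'a \<Rightarrow> 'a" where
  "delta1 mul f \<alpha> \<beta> a b =
     mul \<alpha> \<beta> a (f \<beta> b) - f (\<alpha> * \<beta>) (mul \<alpha> \<beta> a b) + mul \<alpha> \<beta> (f \<alpha> a) b"

definition delta2 ::
  "('w::monoid_mult \<Rightarrow> 'w \<Rightarrow> 'a::ab_group_add \<Rightarrow> 'a \<Rightarrow> 'a) \<Rightarrow>
   ('w \<Rightarrow> 'w \<Rightarrow> 'a \<Rightarrow> 'a \<Rightarrow> 'a) \<Rightarrow> 'w \<Rightarrow> 'w \<Rightarrow> 'w \<Rightarrow> 'a \<Rightarrow> 'a \<Rightarrow> 'a \<Rightarrow> 'a" where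
  "delta2 mul f \<alpha> \<beta> \<gamma> a b c =
     - mul \<alpha> (\<beta> * \<gamma>) a (f \<beta> \<gamma> b c) + f (\<alpha> * \<beta>) \<gamma> (mul \<alpha> \<beta> a b) c
     - f \<alpha> (\<beta> * \<gamma>) a (mul \<beta> \<gamma> b c) + mul (\<alpha> * \<beta>) \<gamma> (f \<alpha> \<beta> a b) c"

definition partial0 ::
  "('w::monoid_mult \<Rightarrow> 'w \<Rightarrow> 'a::ab_group_add \<Rightarrow> 'a \<Rightarrow> 'a) \<Rightarrow> ('w \<Rightarrow> 'a \<Rightarrow> 'a) \<Rightarrow>
   'a \<Rightarrow> 'w \<Rightarrow> 'a \<Rightarrow> 'a" where
  "partial0 mul N m \<alpha> a =
     mul \<alpha> 1 (N \<alpha> a) m - mul 1 \<alpha> m (N \<alpha> a) - N \<alpha> (mul \<alpha> 1 a m - mul 1 \<alpha> m a)"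

text \<open>
  The last summand is missing in the source's formula for \<open>\<partial>\<^sup>1\<close> and is added here
  because \<open>\<partial>\<^sup>1\<close> has to be the linearization in \<open>N\<close> of the Nijenhuis identity, whose
  term \<open>N (N (a b))\<close> contributes both \<open>g (N (a b))\<close> and \<open>N (g (a b))\<close>. Without it
  \<open>d\<^sup>2 \<circ> d\<^sup>1\<close> need not vanish, and vanishing of \<open>H\<^sup>2\<close> does not imply rigidity: for
  \<open>A = k\<close>, \<open>\<Omega> = {1}\<close>, \<open>N = id\<close> the quotient is zero, but \<open>N\<^sub>t = (1 + t) id\<close>
  is a nontrivial deformation.
\<close>

definition partial1 ::
  "('w::monoid_mult \<Rightarrow> 'w \<Rightarrow> 'a::ab_group_add \<Rightarrow> 'a \<Rightarrow> 'a) \<Rightarrow> ('w \<Rightarrow> 'a \<Rightarrow> 'a) \<Rightarrow>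
   ('w \<Rightarrow> 'a \<Rightarrow> 'a) \<Rightarrow> 'w \<Rightarrow> 'w \<Rightarrow> 'a \<Rightarrow> 'a \<Rightarrow> 'a" where
  "partial1 mul N g \<alpha> \<beta> a b =
     mul \<alpha> \<beta> (N \<alpha> a) (g \<beta> b) - N (\<alpha> * \<beta>) (mul \<alpha> \<beta> a (g \<beta> b))
     - g (\<alpha> * \<beta>) (mul \<alpha> \<beta> (N \<alpha> a) b + mul \<alpha> \<beta> a (N \<beta> b) - N (\<alpha> * \<beta>) (mul \<alpha> \<beta> a b))
     + mul \<alpha> \<beta> (g \<alpha> a) (N \<beta> b) - N (\<alpha> * \<beta>) (mul \<alpha> \<beta> (g \<alpha> a) b)
     + N (\<alpha> * \<beta>) (g (\<alpha> * \<beta>) (mul \<alpha> \<beta> a b))"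

definition Phi1 ::
  "('w \<Rightarrow> 'a::ab_group_add \<Rightarrow> 'a) \<Rightarrow> ('w \<Rightarrow> 'a \<Rightarrow> 'a) \<Rightarrow> 'w \<Rightarrow> 'a \<Rightarrow> 'a" where
  "Phi1 N f \<alpha> a = f \<alpha> (N \<alpha> a) - N \<alpha> (f \<alpha> a)"

definition Phi2 ::
  "('w::monoid_mult \<Rightarrow> 'a::ab_group_add \<Rightarrow> 'a) \<Rightarrow>
   ('w \<Rightarrow> 'w \<Rightarrow> 'a \<Rightarrow> 'a \<Rightarrow> 'a) \<Rightarrow> 'w \<Rightarrow> 'w \<Rightarrow> 'a \<Rightarrow> 'a \<Rightarrow> 'a" where
  "Phi2 N f \<alpha> \<beta> a b =
     f \<alpha> \<beta> (N \<alpha> a) (N \<beta> b) - N (\<alpha> * \<beta>) (f \<alpha> \<beta> (N \<alpha> a) b)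
     - N (\<alpha> * \<beta>) (f \<alpha> \<beta> a (N \<beta> b)) + N (\<alpha> * \<beta>) (N (\<alpha> * \<beta>) (f \<alpha> \<beta> a b))"

definition C1_NFA ::
  "('r::comm_ring_1 \<Rightarrow> 'a::ab_group_add \<Rightarrow> 'a) \<Rightarrow> (('w::monoid_mult \<Rightarrow> 'a \<Rightarrow> 'a) \<times> 'a) set" where
  "C1_NFA scale = {(f, m). \<forall>\<alpha>. module_hom scale scale (f \<alpha>)}"

definition C2_NFA ::
  "('r::comm_ring_1 \<Rightarrow> 'a::ab_group_add \<Rightarrow> 'a) \<Rightarrow>
   (('w::monoid_mult \<Rightarrow> 'w \<Rightarrow> 'a \<Rightarrow> 'a \<Rightarrow> 'a) \<times> ('w \<Rightarrow> 'a \<Rightarrow> 'a)) set" where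
  "C2_NFA scale = {(f, g). (\<forall>\<alpha> \<beta>. bilinear_op scale (f \<alpha> \<beta>)) \<and> (\<forall>\<alpha>. module_hom scale scale (g \<alpha>))}"

text \<open>Differences and zero of cochains are the pointwise ones on functions and pairs.\<close>

definition d1_NFA ::
  "('w::monoid_mult \<Rightarrow> 'w \<Rightarrow> 'a::ab_group_add \<Rightarrow> 'a \<Rightarrow> 'a) \<Rightarrow> ('w \<Rightarrow> 'a \<Rightarrow> 'a) \<Rightarrow>
   ('w \<Rightarrow> 'a \<Rightarrow> 'a) \<times> 'a \<Rightarrow> ('w \<Rightarrow> 'w \<Rightarrow> 'a \<Rightarrow> 'a \<Rightarrow> 'a) \<times> ('w \<Rightarrow> 'a \<Rightarrow> 'a)" where
  "d1_NFA mul N = (\<lambda>(f, m). (delta1 mul f, - partial0 mul N m - Phi1 N f))"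

definition d2_NFA ::
  "('w::monoid_mult \<Rightarrow> 'w \<Rightarrow> 'a::ab_group_add \<Rightarrow> 'a \<Rightarrow> 'a) \<Rightarrow> ('w \<Rightarrow> 'a \<Rightarrow> 'a) \<Rightarrow>
   ('w \<Rightarrow> 'w \<Rightarrow> 'a \<Rightarrow> 'a \<Rightarrow> 'a) \<times> ('w \<Rightarrow> 'a \<Rightarrow> 'a) \<Rightarrow>
   ('w \<Rightarrow> 'w \<Rightarrow> 'w \<Rightarrow> 'a \<Rightarrow> 'a \<Rightarrow> 'a \<Rightarrow> 'a) \<times> ('w \<Rightarrow> 'w \<Rightarrow> 'a \<Rightarrow> 'a \<Rightarrow> 'a)" where
  "d2_NFA mul N = (\<lambda>(f, g). (delta2 mul f, - partial1 mul N g - Phi2 N f))"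

definition Z2_NFA where
  "Z2_NFA scale mul N = {c \<in> C2_NFA scale. d2_NFA mul N c = 0}"

definition B2_NFA where
  "B2_NFA scale mul N = d1_NFA mul N ` C1_NFA scale"

text \<open>The quotient space, as the set of cosets; its zero element is the coset \<open>im d\<^sup>1\<close>.\<close>

definition H2_NFA where
  "H2_NFA scale mul N =
     Z2_NFA scale mul N //
       {(c, c'). c \<in> Z2_NFA scale mul N \<and> c' \<in> Z2_NFA scale mul N \<and> c' - c \<in> B2_NFA scale mul N}"

section \<open>Formal deformations\<close>

text \<open>
  Elements of \<open>A[[t]]\<close> are coefficient sequences \<^typ>\<open>nat \<Rightarrow> 'a\<close> with pointwise addition,
  and \<open>k[[t]]\<close> is \<^typ>\<open>'k fps\<close>. A sequence of (bi)linear maps, read as a power series in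
  \<open>t\<close>, extends to \<open>A[[t]]\<close> by the Cauchy product.
\<close>

definition fps_scale ::
  "('k::comm_ring_1 \<Rightarrow> 'a::ab_group_add \<Rightarrow> 'a) \<Rightarrow> 'k fps \<Rightarrow> (nat \<Rightarrow> 'a) \<Rightarrow> nat \<Rightarrow> 'a" where
  "fps_scale scale c x n = (\<Sum>i\<le>n. scale (fps_nth c i) (x (n - i)))"

definition series_map ::
  "(nat \<Rightarrow> 'w \<Rightarrow> 'a::ab_group_add \<Rightarrow> 'a) \<Rightarrow> 'w \<Rightarrow> (nat \<Rightarrow> 'a) \<Rightarrow> nat \<Rightarrow> 'a" where
  "series_map f \<omega> x n = (\<Sum>i\<le>n. f i \<omega> (x (n - i)))"

definition series_mul ::
  "(nat \<Rightarrow> 'w \<Rightarrow> 'w \<Rightarrow> 'a::ab_group_add \<Rightarrow> 'a \<Rightarrow> 'a) \<Rightarrow> 'w \<Rightarrow> 'w \<Rightarrow>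
   (nat \<Rightarrow> 'a) \<Rightarrow> (nat \<Rightarrow> 'a) \<Rightarrow> nat \<Rightarrow> 'a" where
  "series_mul f \<alpha> \<beta> x y n = (\<Sum>i\<le>n. \<Sum>j\<le>n - i. f i \<alpha> \<beta> (x j) (y (n - i - j)))"

definition formal_deformation ::
  "('k::field \<Rightarrow> 'a::ab_group_add \<Rightarrow> 'a) \<Rightarrow>
   ('w::monoid_mult \<Rightarrow> 'w \<Rightarrow> 'a \<Rightarrow> 'a \<Rightarrow> 'a) \<Rightarrow> ('w \<Rightarrow> 'a \<Rightarrow> 'a) \<Rightarrow>
   (nat \<Rightarrow> 'w \<Rightarrow> 'w \<Rightarrow> 'a \<Rightarrow> 'a \<Rightarrow> 'a) \<Rightarrow> (nat \<Rightarrow> 'w \<Rightarrow> 'a \<Rightarrow> 'a) \<Rightarrow> bool" where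
  "formal_deformation scale mul N \<mu> \<nu> \<longleftrightarrow>
     (\<forall>i \<alpha> \<beta>. bilinear_op scale (\<mu> i \<alpha> \<beta>)) \<and>
     (\<forall>i \<omega>. module_hom scale scale (\<nu> i \<omega>)) \<and>
     \<mu> 0 = mul \<and> \<nu> 0 = N \<and>
     nijenhuis_family_algebra (fps_scale scale) (series_mul \<mu>) (series_map \<nu>)"

definition equivalent_deformations ::
  "('k::field \<Rightarrow> 'a::ab_group_add \<Rightarrow> 'a) \<Rightarrow>
   (nat \<Rightarrow> 'w::monoid_mult \<Rightarrow> 'w \<Rightarrow> 'a \<Rightarrow> 'a \<Rightarrow> 'a) \<Rightarrow> (nat \<Rightarrow> 'w \<Rightarrow> 'a \<Rightarrow> 'a) \<Rightarrow>
   (nat \<Rightarrow> 'w \<Rightarrow> 'w \<Rightarrow> 'a \<Rightarrow> 'a \<Rightarrow> 'a) \<Rightarrow> (nat \<Rightarrow> 'w \<Rightarrow> 'a \<Rightarrow> 'a) \<Rightarrow> bool" where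
  "equivalent_deformations scale \<mu> \<nu> \<mu>' \<nu>' \<longleftrightarrow>
     (\<exists>\<psi>. (\<forall>i \<theta>. module_hom scale scale (\<psi> i \<theta>)) \<and> (\<forall>\<theta>. \<psi> 0 \<theta> = id) \<and>
       (\<forall>\<alpha> \<beta> x y. series_map \<psi> (\<alpha> * \<beta>) (series_mul \<mu>' \<alpha> \<beta> x y) =
          series_mul \<mu> \<alpha> \<beta> (series_map \<psi> \<alpha> x) (series_map \<psi> \<beta> y)) \<and>
       (\<forall>\<omega>. series_map \<psi> \<omega> \<circ> series_map \<nu>' \<omega> = series_map \<nu> \<omega> \<circ> series_map \<psi> \<omega>))"

definition trivial_deformation ::
  "('k::field \<Rightarrow> 'a::ab_group_add \<Rightarrow> 'a) \<Rightarrow>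
   ('w::monoid_mult \<Rightarrow> 'w \<Rightarrow> 'a \<Rightarrow> 'a \<Rightarrow> 'a) \<Rightarrow> ('w \<Rightarrow> 'a \<Rightarrow> 'a) \<Rightarrow>
   (nat \<Rightarrow> 'w \<Rightarrow> 'w \<Rightarrow> 'a \<Rightarrow> 'a \<Rightarrow> 'a) \<Rightarrow> (nat \<Rightarrow> 'w \<Rightarrow> 'a \<Rightarrow> 'a) \<Rightarrow> bool" where
  "trivial_deformation scale mul N \<mu> \<nu> \<longleftrightarrow>
     equivalent_deformations scale \<mu> \<nu>
       (\<lambda>i. if i = 0 then mul else 0) (\<lambda>i. if i = 0 then N else 0)"

definition rigid ::
  "('k::field \<Rightarrow> 'a::ab_group_add \<Rightarrow> 'a) \<Rightarrow>
   ('w::monoid_mult \<Rightarrow> 'w \<Rightarrow> 'a \<Rightarrow> 'a \<Rightarrow> 'a) \<Rightarrow> ('w \<Rightarrow> 'a \<Rightarrow> 'a) \<Rightarrow> bool" where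
  "rigid scale mul N \<longleftrightarrow>
     (\<forall>\<mu> \<nu>. formal_deformation scale mul N \<mu> \<nu> \<longrightarrow> trivial_deformation scale mul N \<mu> \<nu>)"

end

theory Submission
  imports Defs
begin

text \<open>
  The isomorphism \<open>\<psi>\<^sub>t\<close> from the trivial deformation is built one order at a time. If
  \<open>\<psi>\<^sub>0 = id, \<dots>, \<psi>\<^bsub>n-1\<^esub>\<close> intertwine the structures modulo \<open>t\<^sup>n\<close>, the defects at order
  \<open>n\<close> of compatibility with the products and with the operators form a pair \<open>(F, G)\<close>.
  Expanding the associativity and the Nijenhuis identity of the deformation on the image of the
  truncated map modulo \<open>t\<^bsup>n+1\<^esup>\<close> shows that \<open>(F, G)\<close> is a 2-cocycle, hence a coboundary
  \<open>d\<^sup>1(f, m)\<close>. As \<open>\<partial>\<^sup>0(m) = \<Phi>\<^sup>1(ad m)\<close> and \<open>\<delta>\<^sup>1(ad m) = 0\<close>, one may replace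
  \<open>(f, m)\<close> by \<open>(f + ad m, 0)\<close>, and \<open>\<psi>\<^sub>n = - (f + ad m)\<close> extends the construction.
\<close>

section \<open>Linear maps, bilinear products and inner derivations\<close>

lemma (in module) module_hom_selfI:
  assumes "\<And>x y. f (x + y) = f x + f y" "\<And>r x. f (scale r x) = scale r (f x)"
  shows "module_hom scale scale f"
  using assms by unfold_locales auto

context omega_associative_algebra
begin

lemma module_hom_mul_left: "module_hom scale scale (\<lambda>a. mul \<alpha> \<beta> a b)"
  using bilinear_mul unfolding bilinear_op_def by blast

lemma module_hom_mul_right: "module_hom scale scale (mul \<alpha> \<beta> a)"
  using bilinear_mul unfolding bilinear_op_def by blast

lemmas mul_add_left = module_hom.add[OF module_hom_mul_left]
lemmas mul_add_right = module_hom.add[OF module_hom_mul_right]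
lemmas mul_diff_left = module_hom.diff[OF module_hom_mul_left]
lemmas mul_diff_right = module_hom.diff[OF module_hom_mul_right]
lemmas mul_neg_left = module_hom.neg[OF module_hom_mul_left]
lemmas mul_neg_right = module_hom.neg[OF module_hom_mul_right]
lemmas mul_zero_left = module_hom.zero[OF module_hom_mul_left]
lemmas mul_zero_right = module_hom.zero[OF module_hom_mul_right]
lemmas mul_scale_left = module_hom.scale[OF module_hom_mul_left]
lemmas mul_scale_right = module_hom.scale[OF module_hom_mul_right]

text \<open>The map ad m of the outline, which is the Hochschild coboundary of the 0-cochain
  \<open>m\<close>. Placing \<open>m\<close> at the unit of \<Omega> makes both products land in
  index \<alpha>.\<close>

definition inner_derivation where
  "inner_derivation m \<alpha> a = mul \<alpha> 1 a m - mul 1 \<alpha> m a"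

lemma module_hom_inner_derivation: "module_hom scale scale (inner_derivation m \<alpha>)"
  unfolding inner_derivation_def
  by (rule module_hom_selfI)
    (simp_all add: mul_add_left mul_add_right mul_scale_left mul_scale_right scale_right_diff_distrib)

text \<open>The case of d o d = 0 in lowest degree: associativity with \<open>m\<close> in third,
  middle and first position cancels the six terms in pairs.\<close>

lemma delta1_inner_derivation: "delta1 mul (inner_derivation m) = 0"
proof (intro ext)
  fix \<alpha> \<beta> a b
  have "mul (\<alpha> * \<beta>) 1 (mul \<alpha> \<beta> a b) m = mul \<alpha> \<beta> a (mul \<beta> 1 b m)"
    using mul_assoc[of \<alpha> \<beta> 1 a b m] by simp
  moreover have "mul \<alpha> \<beta> (mul \<alpha> 1 a m) b = mul \<alpha> \<beta> a (mul 1 \<beta> m b)"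
    using mul_assoc[of \<alpha> 1 \<beta> a m b] by simp
  moreover have "mul \<alpha> \<beta> (mul 1 \<alpha> m a) b = mul 1 (\<alpha> * \<beta>) m (mul \<alpha> \<beta> a b)"
    using mul_assoc[of 1 \<alpha> \<beta> m a b] by simp
  ultimately show "delta1 mul (inner_derivation m) \<alpha> \<beta> a b = 0 \<alpha> \<beta> a b"
    by (simp add: delta1_def inner_derivation_def mul_diff_left mul_diff_right)
qed

text \<open>Regrouping the four products shows this. It allows the element \<open>m\<close> of a
  1-cochain to be absorbed into its family of linear maps.\<close>

lemma partial0_eq_Phi1_inner_derivation: "partial0 mul N m = Phi1 N (inner_derivation m)"
  by (intro ext) (simp add: partial0_def Phi1_def inner_derivation_def)

end

section \<open>Vanishing second cohomology and primitives of cocycles\<close>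

context nijenhuis_family_algebra
begin

lemmas N_add = module_hom.add[OF linear_N]
lemmas N_diff = module_hom.diff[OF linear_N]
lemmas N_neg = module_hom.neg[OF linear_N]
lemmas N_zero = module_hom.zero[OF linear_N]

lemma zero_in_B2_NFA: "0 \<in> B2_NFA scale mul N"
proof -
  have "(0, 0) \<in> C1_NFA scale"
    unfolding C1_NFA_def by (auto intro!: module_hom_selfI)
  moreover have "d1_NFA mul N (0, 0) = 0"
    by (auto simp: d1_NFA_def delta1_def partial0_def Phi1_def fun_eq_iff zero_prod_def
        mul_zero_left mul_zero_right N_zero)
  ultimately show ?thesis unfolding B2_NFA_def by force
qed

text \<open>By hypothesis the only coset is \<open>B2_NFA scale mul N\<close>. The coset of
  \<open>c\<close> is therefore this set, and it contains \<open>c\<close> because zero is a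
  coboundary.\<close>

lemma cocycle_in_B2_NFA:
  assumes H2: "H2_NFA scale mul N = {B2_NFA scale mul N}" and c: "c \<in> Z2_NFA scale mul N"
  shows "c \<in> B2_NFA scale mul N"
proof -
  let ?R = "{(c, c'). c \<in> Z2_NFA scale mul N \<and> c' \<in> Z2_NFA scale mul N \<and> c' - c \<in> B2_NFA scale mul N}"
  have "?R `` {c} \<in> H2_NFA scale mul N"
    unfolding H2_NFA_def using c by (rule quotientI)
  then have "?R `` {c} = B2_NFA scale mul N" using H2 by simp
  moreover have "c \<in> ?R `` {c}" using c zero_in_B2_NFA by simp
  ultimately show ?thesis by blast
qed

lemma B2_NFA_normal_form:
  assumes "(F, G) \<in> B2_NFA scale mul N"
  obtains h where "\<And>\<theta>. module_hom scale scale (h \<theta>)"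
    "\<And>\<alpha> \<beta> a b. F \<alpha> \<beta> a b = - delta1 mul h \<alpha> \<beta> a b" "\<And>\<omega> a. G \<omega> a = Phi1 N h \<omega> a"
proof -
  obtain f m where f: "\<And>\<theta>. module_hom scale scale (f \<theta>)"
    and F: "F = delta1 mul f" and G: "G = - partial0 mul N m - Phi1 N f"
    using assms unfolding B2_NFA_def C1_NFA_def d1_NFA_def by auto
  \<comment> \<open>Adding the inner derivation accounts for \<open>partial0\<close> and is
    invisible to \<open>delta1\<close>. The sign is chosen so that \<open>h\<close> itself can serve
    as the coefficient of order \<open>n\<close>.\<close>
  define h where "h = (\<lambda>\<theta> a. - (f \<theta> a + inner_derivation m \<theta> a))"
  note ad = module_hom_inner_derivation[of m]
  show ?thesis
  proof
    show "module_hom scale scale (h \<theta>)" for \<theta>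
      unfolding h_def
      by (rule module_hom_selfI)
        (simp_all add: module_hom.add[OF f] module_hom.scale[OF f] module_hom.add[OF ad]
          module_hom.scale[OF ad] scale_right_diff_distrib)
    show "F \<alpha> \<beta> a b = - delta1 mul h \<alpha> \<beta> a b" for \<alpha> \<beta> a b
    proof -
      have "delta1 mul (inner_derivation m) \<alpha> \<beta> a b = 0"
        by (simp add: delta1_inner_derivation)
      then show ?thesis
        unfolding F delta1_def h_def
        by (simp add: mul_diff_left mul_diff_right mul_neg_left mul_neg_right algebra_simps)
    qed
    show "G \<omega> a = Phi1 N h \<omega> a" for \<omega> a
      unfolding G partial0_eq_Phi1_inner_derivation
      by (simp add: Phi1_def h_def N_add N_diff N_neg algebra_simps)
  qed
qed

end

section \<open>Dependence of a coefficient on lower orders, and top-degree monomials\<close>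

lemma series_mul_cong:
  assumes "\<And>j. j \<le> n \<Longrightarrow> x j = x' j" "\<And>j. j \<le> n \<Longrightarrow> y j = y' j"
  shows "series_mul f \<alpha> \<beta> x y n = series_mul f \<alpha> \<beta> x' y' n"
  unfolding series_mul_def using assms by (intro sum.cong refl arg_cong2[of _ _ _ _ "f _ _ _"]) auto

lemma series_map_cong:
  assumes "\<And>j. j \<le> n \<Longrightarrow> x j = x' j"
  shows "series_map f \<omega> x n = series_map f \<omega> x' n"
  unfolding series_map_def using assms by (intro sum.cong refl arg_cong[of _ _ "f _ _"]) auto

definition series_monom :: "nat \<Rightarrow> 'a::zero \<Rightarrow> nat \<Rightarrow> 'a" where
  "series_monom n u = (\<lambda>k. if k = n then u else 0)"

text \<open>Here and in the two product versions, the factor of degree \<open>n\<close> exhausts the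
  available degree, so everything else contributes only its coefficient of order 0.\<close>

lemma series_map_monom:
  assumes "\<And>i. f i \<omega> 0 = 0"
  shows "series_map f \<omega> (series_monom n u) n = f 0 \<omega> u"
proof -
  have "series_map f \<omega> (series_monom n u) n = (\<Sum>i\<le>n. if i = 0 then f 0 \<omega> u else 0)"
    unfolding series_map_def by (rule sum.cong) (auto simp: series_monom_def assms)
  then show ?thesis by simp
qed

lemma series_mul_monom_left:
  assumes "\<And>i a. f i \<alpha> \<beta> 0 a = 0"
  shows "series_mul f \<alpha> \<beta> (series_monom n u) y n = f 0 \<alpha> \<beta> u (y 0)"
proof -
  have "(\<Sum>j\<le>n - i. f i \<alpha> \<beta> (series_monom n u j) (y (n - i - j))) =
      (if i = 0 then f 0 \<alpha> \<beta> u (y 0) else 0)" if "i \<le> n" for i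
  proof -
    \<comment> \<open>For j = n, truncated subtraction gives n - i - j = 0, hence the factor
      \<open>y 0\<close>; this j lies in the range only when i = 0.\<close>
    have "(\<Sum>j\<le>n - i. f i \<alpha> \<beta> (series_monom n u j) (y (n - i - j))) =
        (\<Sum>j\<le>n - i. if j = n then f i \<alpha> \<beta> u (y 0) else 0)"
      by (rule sum.cong) (auto simp: series_monom_def assms)
    then show ?thesis using that by auto
  qed
  then show ?thesis unfolding series_mul_def by simp
qed

lemma series_mul_monom_right:
  assumes "\<And>i a. f i \<alpha> \<beta> a 0 = 0"
  shows "series_mul f \<alpha> \<beta> x (series_monom n u) n = f 0 \<alpha> \<beta> (x 0) u"
proof -
  have "(\<Sum>j\<le>n - i. f i \<alpha> \<beta> (x j) (series_monom n u (n - i - j))) =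
      (if i = 0 then f 0 \<alpha> \<beta> (x 0) u else 0)" if "i \<le> n" for i
  proof -
    have "(\<Sum>j\<le>n - i. f i \<alpha> \<beta> (x j) (series_monom n u (n - i - j))) =
        (\<Sum>j\<le>n - i. if j = 0 \<and> i = 0 then f 0 \<alpha> \<beta> (x 0) u else 0)"
      by (rule sum.cong) (use that in \<open>auto simp: series_monom_def assms\<close>)
    then show ?thesis by auto
  qed
  then show ?thesis unfolding series_mul_def by simp
qed

text \<open>The image of the constant series \<open>a\<close> under the map known below order
  \<open>n\<close>, with its top coefficient \<open>u\<close> left free: \<open>u = 0\<close> yields
  the defects, and \<open>u = r \<theta> a\<close> tests a candidate \<open>r\<close> for
  \<open>\<psi> n\<close>.\<close>

definition jet :: "(nat \<Rightarrow> 'w \<Rightarrow> 'a \<Rightarrow> 'a::zero) \<Rightarrow> nat \<Rightarrow> 'w \<Rightarrow> 'a \<Rightarrow> 'a \<Rightarrow> nat \<Rightarrow> 'a" where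
  "jet \<psi> n \<theta> a u k = (if k < n then \<psi> k \<theta> a else if k = n then u else 0)"

section \<open>A fixed deformation, the intertwining conditions and their defects\<close>

locale deformed_algebra = nijenhuis_family_algebra scale mul N
  for scale :: "'k::field \<Rightarrow> 'a::ab_group_add \<Rightarrow> 'a"
    and mul :: "'w::monoid_mult \<Rightarrow> 'w \<Rightarrow> 'a \<Rightarrow> 'a \<Rightarrow> 'a"
    and N :: "'w \<Rightarrow> 'a \<Rightarrow> 'a" +
  fixes \<mu> :: "nat \<Rightarrow> 'w \<Rightarrow> 'w \<Rightarrow> 'a \<Rightarrow> 'a \<Rightarrow> 'a"
    and \<nu> :: "nat \<Rightarrow> 'w \<Rightarrow> 'a \<Rightarrow> 'a"
  assumes formal_deformation: "formal_deformation scale mul N \<mu> \<nu>"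
begin

lemma \<mu>_0: "\<mu> 0 = mul" and \<nu>_0: "\<nu> 0 = N"
  using formal_deformation unfolding formal_deformation_def by auto

lemma module_hom_\<mu>_left: "module_hom scale scale (\<lambda>a. \<mu> i \<alpha> \<beta> a b)"
  and module_hom_\<mu>_right: "module_hom scale scale (\<mu> i \<alpha> \<beta> a)"
  and module_hom_\<nu>: "module_hom scale scale (\<nu> i \<omega>)"
  using formal_deformation unfolding formal_deformation_def bilinear_op_def by blast+

sublocale series: nijenhuis_family_algebra "fps_scale scale" "series_mul \<mu>" "series_map \<nu>"
  using formal_deformation unfolding formal_deformation_def by blast

lemmas \<mu>_zero_left = module_hom.zero[OF module_hom_\<mu>_left]
lemmas \<mu>_zero_right = module_hom.zero[OF module_hom_\<mu>_right]
lemmas \<nu>_zero = module_hom.zero[OF module_hom_\<nu>]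

text \<open>The coefficient of order \<open>n\<close> of the two equivalence equations on constant
  series, with \<open>r\<close> as the coefficient of order \<open>n\<close>. Only values of \<psi>
  below \<open>n\<close> enter, which makes a recursive choice possible.\<close>

definition intertwines_at :: "(nat \<Rightarrow> 'w \<Rightarrow> 'a \<Rightarrow> 'a) \<Rightarrow> nat \<Rightarrow> ('w \<Rightarrow> 'a \<Rightarrow> 'a) \<Rightarrow> bool" where
  "intertwines_at \<psi> n r \<longleftrightarrow>
     (\<forall>\<alpha> \<beta> a b. r (\<alpha> * \<beta>) (mul \<alpha> \<beta> a b) =
        series_mul \<mu> \<alpha> \<beta> (jet \<psi> n \<alpha> a (r \<alpha> a)) (jet \<psi> n \<beta> b (r \<beta> b)) n) \<and>
     (\<forall>\<omega> a. r \<omega> (N \<omega> a) = series_map \<nu> \<omega> (jet \<psi> n \<omega> a (r \<omega> a)) n)"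

text \<open>Orders above \<open>n\<close> do not influence coefficient \<open>n\<close>, so the jet
  can be exchanged for the whole series.\<close>

lemma intertwines_at_iff:
  "intertwines_at \<psi> n (\<psi> n) \<longleftrightarrow>
     (\<forall>\<alpha> \<beta> a b. \<psi> n (\<alpha> * \<beta>) (mul \<alpha> \<beta> a b) =
        series_mul \<mu> \<alpha> \<beta> (\<lambda>k. \<psi> k \<alpha> a) (\<lambda>k. \<psi> k \<beta> b) n) \<and>
     (\<forall>\<omega> a. \<psi> n \<omega> (N \<omega> a) = series_map \<nu> \<omega> (\<lambda>k. \<psi> k \<omega> a) n)"
proof -
  have jet: "jet \<psi> n \<theta> a (\<psi> n \<theta> a) k = \<psi> k \<theta> a" if "k \<le> n" for \<theta> a k
    using that by (auto simp: jet_def)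
  have "series_mul \<mu> \<alpha> \<beta> (jet \<psi> n \<alpha> a (\<psi> n \<alpha> a)) (jet \<psi> n \<beta> b (\<psi> n \<beta> b)) n =
      series_mul \<mu> \<alpha> \<beta> (\<lambda>k. \<psi> k \<alpha> a) (\<lambda>k. \<psi> k \<beta> b) n" for \<alpha> \<beta> a b
    by (rule series_mul_cong) (simp_all add: jet)
  moreover have "series_map \<nu> \<omega> (jet \<psi> n \<omega> a (\<psi> n \<omega> a)) n = series_map \<nu> \<omega> (\<lambda>k. \<psi> k \<omega> a) n" for \<omega> a
    by (rule series_map_cong) (simp add: jet)
  ultimately show ?thesis unfolding intertwines_at_def by simp
qed

text \<open>With the trial value 0 for \<open>\<psi> n\<close>, the left side of the intertwining
  equation vanishes at order \<open>n\<close>, and the right side is all of the obstruction.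
  \<open>N_defect\<close> does the same for the operators.\<close>

definition mul_defect :: "(nat \<Rightarrow> 'w \<Rightarrow> 'a \<Rightarrow> 'a) \<Rightarrow> nat \<Rightarrow> 'w \<Rightarrow> 'w \<Rightarrow> 'a \<Rightarrow> 'a \<Rightarrow> 'a" where
  "mul_defect \<psi> n \<alpha> \<beta> a b = series_mul \<mu> \<alpha> \<beta> (jet \<psi> n \<alpha> a 0) (jet \<psi> n \<beta> b 0) n"

definition N_defect :: "(nat \<Rightarrow> 'w \<Rightarrow> 'a \<Rightarrow> 'a) \<Rightarrow> nat \<Rightarrow> 'w \<Rightarrow> 'a \<Rightarrow> 'a" where
  "N_defect \<psi> n \<omega> a = series_map \<nu> \<omega> (jet \<psi> n \<omega> a 0) n"

section \<open>Jets modulo the power of t after order n\<close>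

context
  fixes \<psi> :: "nat \<Rightarrow> 'w \<Rightarrow> 'a \<Rightarrow> 'a" and n :: nat
  assumes n: "0 < n" and \<psi>_0: "\<And>\<theta>. \<psi> 0 \<theta> = id"
begin

lemma jet_eq_add_monom: "jet \<psi> n \<theta> a u = jet \<psi> n \<theta> a 0 + series_monom n u"
  by (auto simp: jet_def series_monom_def fun_eq_iff)

text \<open>Order \<open>n\<close> is affine in the free top coefficients. Each of them meets only
  \<open>\<mu> 0 = mul\<close> and \<open>\<psi> 0 = id\<close>, and the product of the two has
  degree 2n > n.\<close>

lemma series_mul_jet_top:
  "series_mul \<mu> \<alpha> \<beta> (jet \<psi> n \<alpha> a u) (jet \<psi> n \<beta> b v) n =
     mul_defect \<psi> n \<alpha> \<beta> a b + mul \<alpha> \<beta> u b + mul \<alpha> \<beta> a v"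
proof -
  have "jet \<psi> n \<theta> a u 0 = a" for \<theta> a u using n by (simp add: jet_def \<psi>_0)
  moreover have "series_monom n u 0 = 0" for u :: 'a using n by (simp add: series_monom_def)
  ultimately show ?thesis
    by (subst (1 2) jet_eq_add_monom)
      (simp add: series.mul_add_left series.mul_add_right mul_defect_def \<mu>_0 mul_zero_left
        series_mul_monom_left[where f = \<mu>, OF \<mu>_zero_left]
        series_mul_monom_right[where f = \<mu>, OF \<mu>_zero_right])
qed

lemma series_map_jet_top:
  "series_map \<nu> \<omega> (jet \<psi> n \<omega> a u) n = N_defect \<psi> n \<omega> a + N \<omega> u"
  by (subst jet_eq_add_monom)
    (simp add: series.N_add N_defect_def \<nu>_0 series_map_monom[where f = \<nu>, OF \<nu>_zero])

context
  assumes hom: "\<And>k \<theta>. k < n \<Longrightarrow> module_hom scale scale (\<psi> k \<theta>)"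
    and intertwines: "\<And>k. k < n \<Longrightarrow> intertwines_at \<psi> k (\<psi> k)"
begin

lemma jet_add: "jet \<psi> n \<theta> a u + jet \<psi> n \<theta> b v = jet \<psi> n \<theta> (a + b) (u + v)"
  and jet_diff: "jet \<psi> n \<theta> a u - jet \<psi> n \<theta> b v = jet \<psi> n \<theta> (a - b) (u - v)"
  and jet_scale: "jet \<psi> n \<theta> (scale r a) (scale r u) k = scale r (jet \<psi> n \<theta> a u k)"
  by (auto simp: jet_def fun_eq_iff module_hom.add[OF hom] module_hom.diff[OF hom]
      module_hom.scale[OF hom])

text \<open>Jets are closed under the product up to order \<open>n\<close>: below \<open>n\<close>
  this is the intertwining already achieved, at \<open>n\<close> the top-order formula. Nested
  products can thus be evaluated from the inside out.\<close>

lemma series_mul_jet: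
  assumes "k \<le> n"
  shows "series_mul \<mu> \<alpha> \<beta> (jet \<psi> n \<alpha> a u) (jet \<psi> n \<beta> b v) k =
    jet \<psi> n (\<alpha> * \<beta>) (mul \<alpha> \<beta> a b) (mul_defect \<psi> n \<alpha> \<beta> a b + mul \<alpha> \<beta> u b + mul \<alpha> \<beta> a v) k"
proof (cases "k = n")
  case True
  then show ?thesis by (simp add: series_mul_jet_top) (simp add: jet_def)
next
  case False
  then have k: "k < n" using assms by simp
  have "series_mul \<mu> \<alpha> \<beta> (jet \<psi> n \<alpha> a u) (jet \<psi> n \<beta> b v) k =
      series_mul \<mu> \<alpha> \<beta> (\<lambda>k. \<psi> k \<alpha> a) (\<lambda>k. \<psi> k \<beta> b) k"
    by (rule series_mul_cong) (use k in \<open>simp_all add: jet_def\<close>)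
  then show ?thesis using intertwines[OF k] k unfolding intertwines_at_iff by (simp add: jet_def)
qed

lemma series_map_jet:
  assumes "k \<le> n"
  shows "series_map \<nu> \<omega> (jet \<psi> n \<omega> a u) k =
    jet \<psi> n \<omega> (N \<omega> a) (N_defect \<psi> n \<omega> a + N \<omega> u) k"
proof (cases "k = n")
  case True
  then show ?thesis by (simp add: series_map_jet_top) (simp add: jet_def)
next
  case False
  then have k: "k < n" using assms by simp
  have "series_map \<nu> \<omega> (jet \<psi> n \<omega> a u) k = series_map \<nu> \<omega> (\<lambda>k. \<psi> k \<omega> a) k"
    by (rule series_map_cong) (use k in \<open>simp add: jet_def\<close>)
  then show ?thesis using intertwines[OF k] k unfolding intertwines_at_iff by (simp add: jet_def)
qed

section \<open>The defects form a 2-cocycle\<close>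

lemma bilinear_op_mul_defect: "bilinear_op scale (mul_defect \<psi> n \<alpha> \<beta>)"
proof -
  have add: "jet \<psi> n \<theta> (a + b) 0 = jet \<psi> n \<theta> a 0 + jet \<psi> n \<theta> b 0" for \<theta> a b
    by (simp add: jet_add)
  have scale: "jet \<psi> n \<theta> (scale r a) 0 k = scale r (jet \<psi> n \<theta> a 0 k)" for \<theta> r a k
    using jet_scale[of \<theta> r a 0] by simp
  \<comment> \<open>Additivity is inherited from the product on A[[t]]; homogeneity is checked on
    coefficients, since the scalars there are power series.\<close>
  have "mul_defect \<psi> n \<alpha> \<beta> a (scale r b) = scale r (mul_defect \<psi> n \<alpha> \<beta> a b)" for r a b
    by (simp add: mul_defect_def series_mul_def scale module_hom.scale[OF module_hom_\<mu>_right]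
        scale_sum_right)
  moreover have "mul_defect \<psi> n \<alpha> \<beta> (scale r a) b = scale r (mul_defect \<psi> n \<alpha> \<beta> a b)" for r a b
    by (simp add: mul_defect_def series_mul_def scale module_hom.scale[OF module_hom_\<mu>_left]
        scale_sum_right)
  ultimately show ?thesis
    unfolding bilinear_op_def
    by (auto intro!: module_hom_selfI
        simp: mul_defect_def add series.mul_add_left series.mul_add_right)
qed

lemma module_hom_N_defect: "module_hom scale scale (N_defect \<psi> n \<omega>)"
proof -
  have add: "jet \<psi> n \<theta> (a + b) 0 = jet \<psi> n \<theta> a 0 + jet \<psi> n \<theta> b 0" for \<theta> a b
    by (simp add: jet_add)
  have scale: "jet \<psi> n \<theta> (scale r a) 0 k = scale r (jet \<psi> n \<theta> a 0 k)" for \<theta> r a k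
    using jet_scale[of \<theta> r a 0] by simp
  have "N_defect \<psi> n \<omega> (scale r a) = scale r (N_defect \<psi> n \<omega> a)" for r a
    by (simp add: N_defect_def series_map_def scale module_hom.scale[OF module_hom_\<nu>]
        scale_sum_right)
  then show ?thesis
    by (auto intro!: module_hom_selfI simp: N_defect_def add series.N_add)
qed

lemma delta2_mul_defect: "delta2 mul (mul_defect \<psi> n) = 0"
proof (intro ext)
  fix \<alpha> \<beta> \<gamma> a b c
  let ?F = "mul_defect \<psi> n" and ?J = "\<lambda>\<theta> a. jet \<psi> n \<theta> a 0"
  \<comment> \<open>Up to order \<open>n\<close> the inner product is a jet with the defect as top
    coefficient, so the top-order formula evaluates this bracketing, and likewise the other
    one.\<close>
  have "series_mul \<mu> (\<alpha> * \<beta>) \<gamma> (series_mul \<mu> \<alpha> \<beta> (?J \<alpha> a) (?J \<beta> b)) (?J \<gamma> c) n =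
      series_mul \<mu> (\<alpha> * \<beta>) \<gamma> (jet \<psi> n (\<alpha> * \<beta>) (mul \<alpha> \<beta> a b) (?F \<alpha> \<beta> a b)) (?J \<gamma> c) n"
    by (rule series_mul_cong) (simp_all add: series_mul_jet mul_zero_left mul_zero_right)
  also have "\<dots> = ?F (\<alpha> * \<beta>) \<gamma> (mul \<alpha> \<beta> a b) c + mul (\<alpha> * \<beta>) \<gamma> (?F \<alpha> \<beta> a b) c"
    by (simp add: series_mul_jet_top mul_zero_right)
  finally have left: "series_mul \<mu> (\<alpha> * \<beta>) \<gamma> (series_mul \<mu> \<alpha> \<beta> (?J \<alpha> a) (?J \<beta> b)) (?J \<gamma> c) n = \<dots>" .
  have "series_mul \<mu> \<alpha> (\<beta> * \<gamma>) (?J \<alpha> a) (series_mul \<mu> \<beta> \<gamma> (?J \<beta> b) (?J \<gamma> c)) n =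
      series_mul \<mu> \<alpha> (\<beta> * \<gamma>) (?J \<alpha> a) (jet \<psi> n (\<beta> * \<gamma>) (mul \<beta> \<gamma> b c) (?F \<beta> \<gamma> b c)) n"
    by (rule series_mul_cong) (simp_all add: series_mul_jet mul_zero_left mul_zero_right)
  also have "\<dots> = ?F \<alpha> (\<beta> * \<gamma>) a (mul \<beta> \<gamma> b c) + mul \<alpha> (\<beta> * \<gamma>) a (?F \<beta> \<gamma> b c)"
    by (simp add: series_mul_jet_top mul_zero_left)
  finally show "delta2 mul ?F \<alpha> \<beta> \<gamma> a b c = 0 \<alpha> \<beta> \<gamma> a b c"
    using left series.mul_assoc[of \<alpha> \<beta> \<gamma> "?J \<alpha> a" "?J \<beta> b" "?J \<gamma> c"]
    by (simp add: delta2_def algebra_simps)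
qed

lemma partial1_N_defect: "partial1 mul N (N_defect \<psi> n) + Phi2 N (mul_defect \<psi> n) = 0"
proof (intro ext)
  fix \<alpha> \<beta> a b
  let ?F = "mul_defect \<psi> n" and ?G = "N_defect \<psi> n" and ?J = "\<lambda>\<theta> a. jet \<psi> n \<theta> a 0"
  let ?M = "series_mul \<mu> \<alpha> \<beta>" and ?T = "series_map \<nu>"
  \<comment> \<open>The argument of the outer operator in the Nijenhuis identity for the deformation
    is, up to order \<open>n\<close>, the jet of \<open>?X\<close> with top coefficient
    \<open>?Y\<close>.\<close>
  let ?X = "mul \<alpha> \<beta> (N \<alpha> a) b + mul \<alpha> \<beta> a (N \<beta> b) - N (\<alpha> * \<beta>) (mul \<alpha> \<beta> a b)"
  let ?Y = "?F \<alpha> \<beta> (N \<alpha> a) b + mul \<alpha> \<beta> (?G \<alpha> a) b + (?F \<alpha> \<beta> a (N \<beta> b) + mul \<alpha> \<beta> a (?G \<beta> b))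
    - (?G (\<alpha> * \<beta>) (mul \<alpha> \<beta> a b) + N (\<alpha> * \<beta>) (?F \<alpha> \<beta> a b))"
  have T: "?T \<theta> (?J \<theta> x) k = jet \<psi> n \<theta> (N \<theta> x) (?G \<theta> x) k" if "k \<le> n" for \<theta> x k
    using that by (simp add: series_map_jet N_zero)
  have "?M (?T \<alpha> (?J \<alpha> a)) (?T \<beta> (?J \<beta> b)) n =
      ?M (jet \<psi> n \<alpha> (N \<alpha> a) (?G \<alpha> a)) (jet \<psi> n \<beta> (N \<beta> b) (?G \<beta> b)) n"
    by (rule series_mul_cong) (simp_all add: T)
  then have left: "?M (?T \<alpha> (?J \<alpha> a)) (?T \<beta> (?J \<beta> b)) n =
      ?F \<alpha> \<beta> (N \<alpha> a) (N \<beta> b) + mul \<alpha> \<beta> (?G \<alpha> a) (N \<beta> b) + mul \<alpha> \<beta> (N \<alpha> a) (?G \<beta> b)"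
    by (simp add: series_mul_jet_top)
  have "?M (?T \<alpha> (?J \<alpha> a)) (?J \<beta> b) k =
      jet \<psi> n (\<alpha> * \<beta>) (mul \<alpha> \<beta> (N \<alpha> a) b) (?F \<alpha> \<beta> (N \<alpha> a) b + mul \<alpha> \<beta> (?G \<alpha> a) b) k"
    if "k \<le> n" for k
  proof -
    have "?M (?T \<alpha> (?J \<alpha> a)) (?J \<beta> b) k = ?M (jet \<psi> n \<alpha> (N \<alpha> a) (?G \<alpha> a)) (?J \<beta> b) k"
      by (rule series_mul_cong) (use that in \<open>simp_all add: T\<close>)
    then show ?thesis using that by (simp add: series_mul_jet mul_zero_right)
  qed
  moreover have "?M (?J \<alpha> a) (?T \<beta> (?J \<beta> b)) k =
      jet \<psi> n (\<alpha> * \<beta>) (mul \<alpha> \<beta> a (N \<beta> b)) (?F \<alpha> \<beta> a (N \<beta> b) + mul \<alpha> \<beta> a (?G \<beta> b)) k"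
    if "k \<le> n" for k
  proof -
    have "?M (?J \<alpha> a) (?T \<beta> (?J \<beta> b)) k = ?M (?J \<alpha> a) (jet \<psi> n \<beta> (N \<beta> b) (?G \<beta> b)) k"
      by (rule series_mul_cong) (use that in \<open>simp_all add: T\<close>)
    then show ?thesis using that by (simp add: series_mul_jet mul_zero_left)
  qed
  moreover have "?T (\<alpha> * \<beta>) (?M (?J \<alpha> a) (?J \<beta> b)) k =
      jet \<psi> n (\<alpha> * \<beta>) (N (\<alpha> * \<beta>) (mul \<alpha> \<beta> a b))
        (?G (\<alpha> * \<beta>) (mul \<alpha> \<beta> a b) + N (\<alpha> * \<beta>) (?F \<alpha> \<beta> a b)) k"
    if "k \<le> n" for k
  proof -
    have "?T (\<alpha> * \<beta>) (?M (?J \<alpha> a) (?J \<beta> b)) k =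
        ?T (\<alpha> * \<beta>) (jet \<psi> n (\<alpha> * \<beta>) (mul \<alpha> \<beta> a b) (?F \<alpha> \<beta> a b)) k"
      by (rule series_map_cong)
        (use that in \<open>simp add: series_mul_jet mul_zero_left mul_zero_right\<close>)
    then show ?thesis using that by (simp add: series_map_jet)
  qed
  ultimately have
    "(?M (?T \<alpha> (?J \<alpha> a)) (?J \<beta> b) + ?M (?J \<alpha> a) (?T \<beta> (?J \<beta> b))
        - ?T (\<alpha> * \<beta>) (?M (?J \<alpha> a) (?J \<beta> b))) k = jet \<psi> n (\<alpha> * \<beta>) ?X ?Y k"
    if "k \<le> n" for k
    using that by (simp flip: jet_add jet_diff)
  then have "?T (\<alpha> * \<beta>) (?M (?T \<alpha> (?J \<alpha> a)) (?J \<beta> b) + ?M (?J \<alpha> a) (?T \<beta> (?J \<beta> b))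
        - ?T (\<alpha> * \<beta>) (?M (?J \<alpha> a) (?J \<beta> b))) n = ?T (\<alpha> * \<beta>) (jet \<psi> n (\<alpha> * \<beta>) ?X ?Y) n"
    by (rule series_map_cong)
  also have "\<dots> = ?G (\<alpha> * \<beta>) ?X + N (\<alpha> * \<beta>) ?Y"
    by (rule series_map_jet_top)
  finally have "?F \<alpha> \<beta> (N \<alpha> a) (N \<beta> b) + mul \<alpha> \<beta> (?G \<alpha> a) (N \<beta> b) + mul \<alpha> \<beta> (N \<alpha> a) (?G \<beta> b) =
      ?G (\<alpha> * \<beta>) ?X + N (\<alpha> * \<beta>) ?Y"
    using left series.nijenhuis[of \<alpha> \<beta> "?J \<alpha> a" "?J \<beta> b"] by simp
  \<comment> \<open>The terms in \<open>?F\<close> make up \<open>Phi2\<close> and those in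
    \<open>?G\<close> make up \<open>partial1\<close>, whose last summand stems from
    \<open>?G (\<alpha> * \<beta>) (mul \<alpha> \<beta> a b)\<close> inside
    \<open>?Y\<close>.\<close>
  then show "(partial1 mul N ?G + Phi2 N ?F) \<alpha> \<beta> a b = 0 \<alpha> \<beta> a b"
    by (simp add: partial1_def Phi2_def N_add N_diff algebra_simps)
qed

lemma defects_in_Z2_NFA: "(mul_defect \<psi> n, N_defect \<psi> n) \<in> Z2_NFA scale mul N"
proof -
  have "- partial1 mul N (N_defect \<psi> n) - Phi2 N (mul_defect \<psi> n) = 0"
    using partial1_N_defect by (metis add.inverse_unique diff_self)
  then show ?thesis
    by (simp add: Z2_NFA_def C2_NFA_def d2_NFA_def zero_prod_def delta2_mul_defect
        bilinear_op_mul_defect module_hom_N_defect)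
qed

section \<open>Construction of the intertwiner order by order\<close>

lemma intertwines_at_extend:
  assumes "H2_NFA scale mul N = {B2_NFA scale mul N}"
  obtains r where "\<And>\<theta>. module_hom scale scale (r \<theta>)" "intertwines_at \<psi> n r"
proof -
  obtain h where h: "\<And>\<theta>. module_hom scale scale (h \<theta>)"
    and F: "\<And>\<alpha> \<beta> a b. mul_defect \<psi> n \<alpha> \<beta> a b = - delta1 mul h \<alpha> \<beta> a b"
    and G: "\<And>\<omega> a. N_defect \<psi> n \<omega> a = Phi1 N h \<omega> a"
    using B2_NFA_normal_form[OF cocycle_in_B2_NFA[OF assms defects_in_Z2_NFA]] by metis
  \<comment> \<open>By the top-order formulas the two conditions on \<open>h\<close> say exactly
    that the defects are \<open>- delta1 mul h\<close> and \<open>Phi1 N h\<close>.\<close>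
  have "intertwines_at \<psi> n h"
    unfolding intertwines_at_def
    by (simp add: series_mul_jet_top series_map_jet_top F G delta1_def Phi1_def)
  with h show ?thesis using that by blast
qed

end

end

lemma exists_intertwiner:
  assumes "H2_NFA scale mul N = {B2_NFA scale mul N}"
  obtains \<psi> where "\<And>i \<theta>. module_hom scale scale (\<psi> i \<theta>)" "\<And>\<theta>. \<psi> 0 \<theta> = id"
    "\<And>i. intertwines_at \<psi> i (\<psi> i)"
proof -
  let ?P = "\<lambda>\<psi> n r. (\<forall>\<theta>. module_hom scale scale (r \<theta>)) \<and> (n = 0 \<longrightarrow> (\<forall>\<theta>. r \<theta> = id)) \<and>
    intertwines_at \<psi> n r"
  have "\<exists>\<psi>. \<forall>n. ?P \<psi> n (\<psi> n)"
  proof (rule dependent_wellorder_choice)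
    fix r :: "'w \<Rightarrow> 'a \<Rightarrow> 'a" and f g :: "nat \<Rightarrow> 'w \<Rightarrow> 'a \<Rightarrow> 'a" and n :: nat
    \<comment> \<open>The condition at \<open>n\<close> reads the sequence only through the jet,
      hence only below \<open>n\<close>.\<close>
    assume "\<And>k. k < n \<Longrightarrow> f k = g k"
    then have "jet f n = jet g n" by (simp add: jet_def fun_eq_iff)
    then show "?P f n r = ?P g n r" by (simp add: intertwines_at_def)
  next
    fix n and \<psi> :: "nat \<Rightarrow> 'w \<Rightarrow> 'a \<Rightarrow> 'a"
    assume prev: "\<And>k. k < n \<Longrightarrow> ?P \<psi> k (\<psi> k)"
    show "\<exists>r. ?P \<psi> n r"
    proof (cases "n = 0")
      case True
      \<comment> \<open>At order 0 both equations hold because the deformation starts with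
        \<open>mul\<close> and \<open>N\<close>.\<close>
      have "?P \<psi> 0 (\<lambda>_. id)"
        by (auto intro!: module_hom_selfI
            simp: intertwines_at_def series_mul_def series_map_def jet_def \<mu>_0 \<nu>_0)
      then show ?thesis unfolding True by (rule exI[of _ "\<lambda>_. id"])
    next
      case False
      then have "0 < n" by simp
      moreover have "\<psi> 0 \<theta> = id" for \<theta> using prev[OF \<open>0 < n\<close>] by blast
      moreover have "module_hom scale scale (\<psi> k \<theta>)" if "k < n" for k \<theta> using prev[OF that] by blast
      moreover have "intertwines_at \<psi> k (\<psi> k)" if "k < n" for k using prev[OF that] by blast
      ultimately obtain r where "\<And>\<theta>. module_hom scale scale (r \<theta>)" "intertwines_at \<psi> n r"
        using intertwines_at_extend[of n \<psi>] assms by metis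
      then show ?thesis using \<open>0 < n\<close> by blast
    qed
  qed
  then show ?thesis using that by blast
qed

section \<open>From intertwining on A to intertwining on A[[t]]\<close>

lemma series_mul_intertwiner:
  assumes hom: "\<And>i \<theta>. module_hom scale scale (\<psi> i \<theta>)"
    and mult: "\<And>i \<alpha> \<beta> a b. \<psi> i (\<alpha> * \<beta>) (mul \<alpha> \<beta> a b) =
      series_mul \<mu> \<alpha> \<beta> (\<lambda>k. \<psi> k \<alpha> a) (\<lambda>k. \<psi> k \<beta> b) i"
  shows "series_map \<psi> (\<alpha> * \<beta>) (series_mul (\<lambda>i. if i = 0 then mul else 0) \<alpha> \<beta> x y) =
    series_mul \<mu> \<alpha> \<beta> (series_map \<psi> \<alpha> x) (series_map \<psi> \<beta> y)"
proof
  fix n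
  have const: "series_mul (\<lambda>i. if i = 0 then mul else 0) \<alpha> \<beta> x y k =
      (\<Sum>j\<le>k. mul \<alpha> \<beta> (x j) (y (k - j)))" for k
  proof -
    have "series_mul (\<lambda>i. if i = 0 then mul else 0) \<alpha> \<beta> x y k =
        (\<Sum>i\<le>k. if i = 0 then (\<Sum>j\<le>k. mul \<alpha> \<beta> (x j) (y (k - j))) else 0)"
      unfolding series_mul_def by (rule sum.cong) auto
    then show ?thesis by simp
  qed
  \<comment> \<open>The orders \<open>p, q, r, j, l\<close> of the factors sum to \<open>n\<close>; on the left \<open>i = p + q + r\<close> is
    fixed first, on the right \<open>p\<close> and \<open>s = q + j\<close>.\<close>
  let ?t = "\<lambda>p q r j l. \<mu> p \<alpha> \<beta> (\<psi> q \<alpha> (x j)) (\<psi> r \<beta> (y l))"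
  have "series_map \<psi> (\<alpha> * \<beta>) (series_mul (\<lambda>i. if i = 0 then mul else 0) \<alpha> \<beta> x y) n =
      (\<Sum>i\<le>n. \<Sum>j\<le>n - i. \<Sum>p\<le>i. \<Sum>q\<le>i - p. ?t p q (i - p - q) j (n - i - j))"
    by (simp add: series_map_def const module_hom.sum[OF hom] mult) (simp add: series_mul_def)
  also have "\<dots> = (\<Sum>(i, j, p, q)\<in>(SIGMA i:{..n}. SIGMA j:{..n - i}. SIGMA p:{..i}. {..i - p}).
      ?t p q (i - p - q) j (n - i - j))"
    by (simp add: sum.Sigma)
  also have "\<dots> = (\<Sum>(p, s, q, r)\<in>(SIGMA p:{..n}. SIGMA s:{..n - p}. SIGMA q:{..s}. {..n - p - s}).
      ?t p q r (s - q) (n - p - s - r))"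
    by (rule sum.reindex_bij_witness[where i = "\<lambda>(p, s, q, r). (p + q + r, s - q, p, q)"
          and j = "\<lambda>(i, j, p, q). (p, q + j, q, i - p - q)"]) (auto simp: add.commute)
  also have "\<dots> = (\<Sum>p\<le>n. \<Sum>s\<le>n - p. \<Sum>q\<le>s. \<Sum>r\<le>n - p - s. ?t p q r (s - q) (n - p - s - r))"
    by (simp add: sum.Sigma)
  also have "\<dots> = series_mul \<mu> \<alpha> \<beta> (series_map \<psi> \<alpha> x) (series_map \<psi> \<beta> y) n"
    by (simp add: series_mul_def series_map_def module_hom.sum[OF module_hom_\<mu>_left])
      (simp add: module_hom.sum[OF module_hom_\<mu>_right])
  finally show "series_map \<psi> (\<alpha> * \<beta>) (series_mul (\<lambda>i. if i = 0 then mul else 0) \<alpha> \<beta> x y) n = \<dots>" .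
qed

text \<open>The orders of \<nu>, \<psi> and \<open>x\<close> sum to \<open>n\<close>. One side fixes
  the joint order of \<nu> and \<psi> first, the other the order of \<nu>, so reindexing the double
  sum suffices.\<close>

lemma series_map_intertwiner:
  assumes map: "\<And>i a. \<psi> i \<omega> (N \<omega> a) = series_map \<nu> \<omega> (\<lambda>k. \<psi> k \<omega> a) i"
  shows "series_map \<psi> \<omega> (series_map (\<lambda>i. if i = 0 then N else 0) \<omega> x) =
    series_map \<nu> \<omega> (series_map \<psi> \<omega> x)"
proof
  fix n
  have const: "series_map (\<lambda>i. if i = 0 then N else 0) \<omega> x k = N \<omega> (x k)" for k
  proof -
    have "series_map (\<lambda>i. if i = 0 then N else 0) \<omega> x k = (\<Sum>i\<le>k. if i = 0 then N \<omega> (x k) else 0)"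
      unfolding series_map_def by (rule sum.cong) auto
    then show ?thesis by simp
  qed
  let ?t = "\<lambda>p q j. \<nu> p \<omega> (\<psi> q \<omega> (x j))"
  have "series_map \<psi> \<omega> (series_map (\<lambda>i. if i = 0 then N else 0) \<omega> x) n =
      (\<Sum>i\<le>n. \<Sum>p\<le>i. ?t p (i - p) (n - i))"
    by (simp add: series_map_def[of \<psi>] const map) (simp add: series_map_def)
  also have "\<dots> = (\<Sum>(i, p)\<in>(SIGMA i:{..n}. {..i}). ?t p (i - p) (n - i))"
    by (simp add: sum.Sigma)
  also have "\<dots> = (\<Sum>(p, q)\<in>(SIGMA p:{..n}. {..n - p}). ?t p q (n - p - q))"
    by (rule sum.reindex_bij_witness[where i = "\<lambda>(p, q). (p + q, p)"
          and j = "\<lambda>(i, p). (p, i - p)"]) auto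
  also have "\<dots> = (\<Sum>p\<le>n. \<Sum>q\<le>n - p. ?t p q (n - p - q))"
    by (simp add: sum.Sigma)
  also have "\<dots> = series_map \<nu> \<omega> (series_map \<psi> \<omega> x) n"
    by (simp add: series_map_def module_hom.sum[OF module_hom_\<nu>])
  finally show "series_map \<psi> \<omega> (series_map (\<lambda>i. if i = 0 then N else 0) \<omega> x) n = \<dots>" .
qed

text \<open>In \<open>equivalent_deformations\<close> the map \<psi> leads from the second
  structure, here the trivial one, to the first. This is the direction of the constructed
  intertwiner.\<close>

lemma trivial_deformation:
  assumes "H2_NFA scale mul N = {B2_NFA scale mul N}"
  shows "trivial_deformation scale mul N \<mu> \<nu>"
proof -
  obtain \<psi> where hom: "\<And>i \<theta>. module_hom scale scale (\<psi> i \<theta>)" and id: "\<And>\<theta>. \<psi> 0 \<theta> = id"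
    and "\<And>i. intertwines_at \<psi> i (\<psi> i)"
    using exists_intertwiner[OF assms] by blast
  then have
    mult: "\<And>i \<alpha> \<beta> a b. \<psi> i (\<alpha> * \<beta>) (mul \<alpha> \<beta> a b) =
      series_mul \<mu> \<alpha> \<beta> (\<lambda>k. \<psi> k \<alpha> a) (\<lambda>k. \<psi> k \<beta> b) i"
    and map: "\<And>i \<omega> a. \<psi> i \<omega> (N \<omega> a) = series_map \<nu> \<omega> (\<lambda>k. \<psi> k \<omega> a) i"
    unfolding intertwines_at_iff by blast+
  show ?thesis
    unfolding trivial_deformation_def equivalent_deformations_def
    by (intro exI[of _ \<psi>] conjI allI hom id ext)
      (simp_all only: o_apply series_mul_intertwiner[of \<psi>, OF hom mult] series_map_intertwiner[of \<psi>, OF map])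
qed

end

theorem theorem4p6:
  fixes scale :: "'k::field \<Rightarrow> 'a::ab_group_add \<Rightarrow> 'a"
    and mul :: "'w::monoid_mult \<Rightarrow> 'w \<Rightarrow> 'a \<Rightarrow> 'a \<Rightarrow> 'a"
    and N :: "'w \<Rightarrow> 'a \<Rightarrow> 'a"
  assumes "nijenhuis_family_algebra scale mul N"
    and "H2_NFA scale mul N = {B2_NFA scale mul N}"
  shows "rigid scale mul N"
  unfolding rigid_def
proof (intro allI impI)
  fix \<mu> \<nu>
  assume "formal_deformation scale mul N \<mu> \<nu>"
  then interpret deformed_algebra scale mul N \<mu> \<nu>
    by (intro deformed_algebra.intro deformed_algebra_axioms.intro assms(1))
  show "trivial_deformation scale mul N \<mu> \<nu>"
    using assms(2) by (rule trivial_deformation)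
qed

end
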